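(* Let $p, q \in \mathbb{N}$ with $p < q$, and let $n \in \mathbb{N}$. Then: - $|M_{p,q,n}| = 0$ if $n \le q-1$; - $|M_{p,q,n}| = 1$ if $q \le n \le 2q-1$; - if $n \ge 2q$, then $$|M_{p,q,n}| \ =\ 1 + (n-2p) + \sum_{3 \le k \le \frac{n+2}{q+1}}\ \sum_{i=qk}^{n+2-k} (i-pk)\binom{n-i-1}{k-3},$$ where $k$ ranges over integers.
   Context: $\mathbb{N} = \{1,2,3,\dots\}$. For a finite nonempty set $S \subseteq \mathbb{N}$, $|S|$ denotes its cardinality and $\min_2 S$ denotes its second smallest element if $|S| \ge 2$; if $|S| = 1$, then $\min_2 S$ is by convention the unique element of $S$ (so $\min_2 S = \min S$). For $p, q, n \in \mathbb{N}$, define $$M_{p,q,n} := \{S \subseteq \mathbb{N} : S \text{ is finite and nonempty},\ \max S = n,\ \min S \ge p|S|,\ \textstyle\min_2 S \ge q|S|\}.$$ Empty sums are $0$, and $\binom{a}{j} = 0$ for integers $0 \le a < j$. *)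

theory Defs
  imports Complex_Main
begin

text \<open>Here the natural numbers start at 1, so subsets of them are sets \<open>S \<subseteq> {1..}\<close> of type \<open>nat set\<close>.\<close>

text \<open>Second smallest element of a finite nonempty set; for a singleton, by convention, its only element.\<close>

definition Min2 :: "nat set \<Rightarrow> nat" where
  "Min2 S = (if card S \<ge> 2 then Min (S - {Min S}) else Min S)"

definition M :: "nat \<Rightarrow> nat \<Rightarrow> nat \<Rightarrow> nat set set" where
  "M p q n = {S. S \<subseteq> {1..} \<and> finite S \<and> S \<noteq> {} \<and> Max S = n \<and>
                 Min S \<ge> p * card S \<and> Min2 S \<ge> q * card S}"

text \<open>Since \<open>card\<close> is 0 on infinite sets, finiteness is what makes \<open>card (M p q n)\<close> the true cardinality.\<close>

lemma finite_M: "finite (M p q n)"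
proof (rule finite_subset)
  show "M p q n \<subseteq> Pow {..n}"
    unfolding M_def by auto
qed simp

end

theory Submission
  imports Defs
begin

text \<open>
  The sets in \<open>M p q n\<close> are counted according to their cardinality \<open>k\<close>, because the two lower
  bounds \<open>p * k\<close> and \<open>q * k\<close> are constant once \<open>k\<close> is known. The only candidate with \<open>k = 1\<close> is
  \<open>{n}\<close>. For \<open>k = 2\<close> the second smallest element is \<open>n\<close> itself, and the smallest is free in
  \<open>{2 * p..<n}\<close>; this is the term \<open>n - 2 * p\<close>. For \<open>k \<ge> 3\<close> the smallest element \<open>a\<close>, the second
  smallest element \<open>i\<close> and the largest element \<open>n\<close> are three different points, and such a set is
  determined by \<open>a\<close>, \<open>i\<close> and the remaining \<open>k - 3\<close> elements, which form an arbitrary subset of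
  \<open>{i<..<n}\<close>. Given \<open>i\<close>, there are \<open>i - p * k\<close> choices for \<open>a\<close> and \<open>(n - i - 1) choose (k - 3)\<close>
  choices for the rest, which yields the inner sum (lemma \<open>card_M_of_card_ge_3\<close>).

  The interval \<open>{i<..<n}\<close> has to accommodate \<open>k - 3\<close> elements, so \<open>i \<le> n + 2 - k\<close>. Combined with
  \<open>q * k \<le> i\<close> this forces \<open>k * (q + 1) \<le> n + 2\<close>, which is the range of the outer sum. If
  \<open>n < 2 * q\<close>, this range is empty and no set with two elements qualifies either, so that at most
  \<open>{n}\<close> remains.
\<close>

section \<open>Sets with prescribed extreme elements\<close>

lemma Min2_eq: "2 \<le> card S \<Longrightarrow> Min2 S = Min (S - {Min S})"
  by (simp add: Min2_def)

lemma extremes_of_insert3: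
  fixes a i n :: nat
  assumes "a < i" "i < n" "T \<subseteq> {i<..<n}"
  defines "S \<equiv> insert a (insert i (insert n T))"
  shows "finite S" "card S = card T + 3" "Min S = a" "Min2 S = i" "Max S = n"
    "S - {a, i, n} = T"
proof -
  have finT: "finite T"
    using assms(3) finite_subset by blast
  have notin: "a \<notin> T" "i \<notin> T" "n \<notin> T"
    using assms by auto
  show fin: "finite S"
    using finT by (simp add: S_def)
  show card: "card S = card T + 3"
    using assms(1,2) finT notin by (simp add: S_def)
  show Min: "Min S = a"
    by (rule Min_eqI[OF fin]) (use assms in auto)
  have "Min (S - {a}) = i"
    by (rule Min_eqI) (use fin assms in auto)
  then show "Min2 S = i"
    using card Min by (simp add: Min2_eq)
  show "Max S = n"
    by (rule Max_eqI[OF fin]) (use assms in auto)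
  show "S - {a, i, n} = T"
    using notin by (auto simp: S_def)
qed

lemma Min_less_Min2:
  assumes "finite S" "2 \<le> card S"
  shows "Min2 S \<in> S" "Min S < Min2 S"
    and "\<And>x. x \<in> S \<Longrightarrow> x \<noteq> Min S \<Longrightarrow> Min2 S \<le> x"
proof -
  have "S \<noteq> {}"
    using assms by auto
  have "card (S - {Min S}) = card S - 1"
    using assms \<open>S \<noteq> {}\<close> by (simp add: card_Diff_singleton)
  then have "S - {Min S} \<noteq> {}"
    using assms(2) by (metis Suc_1 card.empty diff_is_0_eq not_less_eq_eq)
  then have in2: "Min2 S \<in> S - {Min S}"
    using assms Min_in[of "S - {Min S}"] by (simp add: Min2_eq)
  then show "Min2 S \<in> S"
    by simp
  show "Min S < Min2 S"
    using in2 assms(1) by (simp add: order.not_eq_order_implies_strict)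
  show "Min2 S \<le> x" if "x \<in> S" "x \<noteq> Min S" for x
    using that assms by (simp add: Min2_eq)
qed

lemma Min2_less_Max:
  assumes "finite S" "3 \<le> card S"
  shows "Min2 S < Max S"
proof (rule ccontr)
  assume "\<not> Min2 S < Max S"
  then have "S \<subseteq> {Min S, Min2 S}"
    using assms Min_less_Min2(3)[of S] by (fastforce dest: Max_ge)
  then have "card S \<le> card {Min S, Min2 S}"
    by (intro card_mono) auto
  also have "\<dots> \<le> 2"
    by (simp add: card_insert_if)
  finally show False
    using assms(2) by simp
qed

lemma between_Min2_and_Max:
  assumes "finite S" "3 \<le> card S"
  shows "S - {Min S, Min2 S, Max S} \<subseteq> {Min2 S<..<Max S}"
    and "insert (Min S) (insert (Min2 S) (insert (Max S) (S - {Min S, Min2 S, Max S}))) = S"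
    and "card (S - {Min S, Min2 S, Max S}) = card S - 3"
proof -
  have "S \<noteq> {}"
    using assms by auto
  show sub: "S - {Min S, Min2 S, Max S} \<subseteq> {Min2 S<..<Max S}"
  proof
    fix x assume x: "x \<in> S - {Min S, Min2 S, Max S}"
    then have "Min2 S \<le> x" "x \<le> Max S"
      using assms Min_less_Min2(3)[of S x] by auto
    with x show "x \<in> {Min2 S<..<Max S}"
      by auto
  qed
  have "Min2 S \<in> S"
    using Min_less_Min2(1)[OF assms(1)] assms(2) by simp
  then show eq: "insert (Min S) (insert (Min2 S) (insert (Max S) (S - {Min S, Min2 S, Max S}))) = S"
    using Min_in[OF assms(1) \<open>S \<noteq> {}\<close>] Max_in[OF assms(1) \<open>S \<noteq> {}\<close>] by blast
  show "card (S - {Min S, Min2 S, Max S}) = card S - 3"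
    using extremes_of_insert3(2)[OF _ Min2_less_Max[OF assms] sub, of "Min S"] assms
      Min_less_Min2(2)[of S] unfolding eq by simp
qed

section \<open>Counting by cardinality\<close>

text \<open>For a singleton both bounds concern \<open>n\<close>, and the one with \<open>q\<close> is the stronger one.\<close>

lemma M_of_card_1:
  assumes "p \<ge> 1" "p < q"
  shows "{S \<in> M p q n. card S = 1} = (if q \<le> n then {{n}} else {})"
  using assms by (auto simp: M_def Min2_def card_1_singleton_iff)

lemma M_of_card_2:
  assumes "p \<ge> 1"
  shows "{S \<in> M p q n. card S = 2} = (if 2 * q \<le> n then (\<lambda>a. {a, n}) ` {2 * p..<n} else {})"
    (is "?L = ?R")
proof
  show "?L \<subseteq> ?R"
  proof
    fix S assume S: "S \<in> ?L"
    then obtain a b where ab: "S = {a, b}" "a < b"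
      by (auto simp: card_2_iff) (metis insert_commute linorder_neqE_nat)
    then have "Min S = a" "Max S = b" "S - {a} = {b}"
      by auto
    then have "a \<ge> 2 * p" "b \<ge> 2 * q" "b = n"
      using S by (auto simp: M_def Min2_def)
    then show "S \<in> ?R"
      using ab by auto
  qed
  show "?R \<subseteq> ?L"
  proof
    fix S assume "S \<in> ?R"
    then obtain a where a: "2 * q \<le> n" "2 * p \<le> a" "a < n" "S = {a, n}"
      by (auto split: if_splits)
    then have "card S = 2" "Min S = a" "Max S = n" "S - {a} = {n}"
      by auto
    with a assms show "S \<in> ?L"
      by (auto simp: M_def Min2_def)
  qed
qed

lemma card_M_of_card_2:
  assumes "p \<ge> 1"
  shows "card {S \<in> M p q n. card S = 2} = (if 2 * q \<le> n then n - 2 * p else 0)"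
proof -
  have "inj_on (\<lambda>a. {a, n}) {2 * p..<n}"
    by (auto simp: inj_on_def doubleton_eq_iff)
  then show ?thesis
    unfolding M_of_card_2[OF assms] by (simp add: card_image)
qed

text \<open>The elements strictly between \<open>Min2 S\<close> and \<open>Max S\<close> need room.\<close>

lemma Min2_bounds_in_M:
  assumes "S \<in> M p q n" "3 \<le> card S"
  shows "q * card S \<le> Min2 S" "Min2 S + card S \<le> n + 2"
proof -
  have S: "finite S" "Max S = n" "q * card S \<le> Min2 S"
    using assms(1) by (auto simp: M_def)
  show "q * card S \<le> Min2 S"
    by (fact S)
  have "card (S - {Min S, Min2 S, Max S}) \<le> card {Min2 S<..<n}"
    using between_Min2_and_Max(1)[OF S(1) assms(2)] S(2) by (intro card_mono) auto
  then show "Min2 S + card S \<le> n + 2"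
    using between_Min2_and_Max(3)[OF S(1) assms(2)] Min2_less_Max[OF S(1) assms(2)] S(2) assms(2)
    by simp
qed

text \<open>
  Once the second smallest element \<open>i\<close> is fixed, the smallest element and the set \<open>T\<close> of elements
  between \<open>i\<close> and the maximum can be chosen independently. This is why \<open>i\<close> comes first: the
  other two coordinates range over a Cartesian product.
\<close>

lemma bij_betw_M_of_card_ge_3:
  assumes "p \<ge> 1" "3 \<le> k"
  shows "bij_betw (\<lambda>(i, a, T). insert a (insert i (insert n T)))
    (SIGMA i:{q * k..n + 2 - k}. {p * k..<i} \<times> {T. T \<subseteq> {i<..<n} \<and> card T = k - 3})
    {S \<in> M p q n. card S = k}"
    (is "bij_betw ?f ?A ?B")
proof (rule bij_betw_byWitness[where f' = "\<lambda>S. (Min2 S, Min S, S - {Min S, Min2 S, n})"])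
  have dec: "a < i \<and> i < n \<and> T \<subseteq> {i<..<n}" if "(i, a, T) \<in> ?A" for i a T
    using that assms(2) by auto
  show "\<forall>x\<in>?A. (Min2 (?f x), Min (?f x), ?f x - {Min (?f x), Min2 (?f x), n}) = x"
  proof
    fix x assume x: "x \<in> ?A"
    obtain i a T where iaT: "x = (i, a, T)"
      by (cases x)
    have "a < i" "i < n" "T \<subseteq> {i<..<n}"
      using dec x unfolding iaT by blast+
    note ext = extremes_of_insert3(3,4,6)[OF this]
    show "(Min2 (?f x), Min (?f x), ?f x - {Min (?f x), Min2 (?f x), n}) = x"
      by (simp only: iaT prod.case ext)
  qed
  show "\<forall>S\<in>?B. ?f (Min2 S, Min S, S - {Min S, Min2 S, n}) = S"
    using assms(2) between_Min2_and_Max(2) by (auto simp: M_def)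
  show "?f ` ?A \<subseteq> ?B"
  proof
    fix S assume "S \<in> ?f ` ?A"
    then obtain i a T where x: "(i, a, T) \<in> ?A" and S: "S = insert a (insert i (insert n T))"
      by auto
    have aiT: "a < i" "i < n" "T \<subseteq> {i<..<n}"
      using dec[OF x] by auto
    note ext = extremes_of_insert3[OF aiT, folded S]
    have card: "card S = k"
      using ext(2) x assms(2) by auto
    have "0 < p * k" "p * k \<le> a"
      using assms x by auto
    then have "0 < a"
      by (rule order.strict_trans2)
    moreover have "a \<le> y" if "y \<in> S" for y
      using ext(1,3) that by auto
    ultimately have "S \<subseteq> {1..}"
      by force
    then show "S \<in> ?B"
      using ext card x S by (auto simp: M_def)
  qed
  show "(\<lambda>S. (Min2 S, Min S, S - {Min S, Min2 S, n})) ` ?B \<subseteq> ?A"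
  proof
    fix x assume "x \<in> (\<lambda>S. (Min2 S, Min S, S - {Min S, Min2 S, n})) ` ?B"
    then obtain S where S: "S \<in> M p q n" "card S = k"
      and x: "x = (Min2 S, Min S, S - {Min S, Min2 S, n})"
      by auto
    have "finite S" "Max S = n" "p * k \<le> Min S"
      using S by (auto simp: M_def)
    then show "x \<in> ?A"
      using Min2_bounds_in_M[OF S(1)] Min_less_Min2(2)[of S] between_Min2_and_Max(1,3)[of S]
        S(2) assms(2) x by auto
  qed
qed

lemma card_M_of_card_ge_3:
  assumes "p \<ge> 1" "p < q" "3 \<le> k"
  shows "int (card {S \<in> M p q n. card S = k}) =
    (\<Sum>i = q * k..n + 2 - k. (int i - int p * int k) * int ((n - i - 1) choose (k - 3)))"
proof -
  have "card {S \<in> M p q n. card S = k} =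
    (\<Sum>i = q * k..n + 2 - k. (i - p * k) * ((n - i - 1) choose (k - 3)))"
    using bij_betw_same_card[OF bij_betw_M_of_card_ge_3[OF assms(1,3), where q = q and n = n]]
    by (simp add: card_cartesian_product n_subsets)
  moreover have "p * k \<le> i" if "q * k \<le> i" for i
    using that assms(2) mult_le_mono1[of p q k] by linarith
  ultimately show ?thesis
    by (auto simp: of_nat_diff intro!: sum.cong)
qed

section \<open>The total count\<close>

lemma card_M:
  assumes "p \<ge> 1" "p < q"
  shows "int (card (M p q n)) =
    (if q \<le> n then 1 else 0) + (if 2 * q \<le> n then int n - 2 * int p else 0) +
    (\<Sum>k | 3 \<le> k \<and> k * (q + 1) \<le> n + 2.
      \<Sum>i = q * k..n + 2 - k. (int i - int p * int k) * int ((n - i - 1) choose (k - 3)))"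
proof -
  let ?F = "\<lambda>k. {S \<in> M p q n. card S = k}"
  let ?K = "{k. 3 \<le> k \<and> k * (q + 1) \<le> n + 2}"
  have "k \<le> n + 2" if "k \<in> ?K" for k
    using that by simp
  then have finK: "finite ?K"
    by (meson finite_nat_set_iff_bounded_le)
  have "card S \<in> {1, 2} \<union> ?K" if S: "S \<in> M p q n" for S
  proof (cases "3 \<le> card S")
    case True
    then show ?thesis
      using Min2_bounds_in_M[OF S True] by (simp add: mult.commute)
  next
    case False
    moreover have "card S \<noteq> 0"
      using S by (simp add: M_def)
    ultimately show ?thesis
      by auto
  qed
  then have "M p q n = (\<Union>k\<in>{1, 2} \<union> ?K. ?F k)"
    by auto
  then have "card (M p q n) = card (\<Union>k\<in>{1, 2} \<union> ?K. ?F k)"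
    by (rule arg_cong)
  also have "\<dots> = (\<Sum>k\<in>{1, 2} \<union> ?K. card (?F k))"
    using finK finite_M by (intro card_UN_disjoint) auto
  also have "\<dots> = card (?F 1) + card (?F 2) + (\<Sum>k\<in>?K. card (?F k))"
    using finK by (subst sum.union_disjoint) auto
  finally have "int (card (M p q n)) =
      int (card (?F 1)) + int (card (?F 2)) + (\<Sum>k\<in>?K. int (card (?F k)))"
    by simp
  moreover have "(\<Sum>k\<in>?K. int (card (?F k))) = (\<Sum>k\<in>?K. \<Sum>i = q * k..n + 2 - k.
      (int i - int p * int k) * int ((n - i - 1) choose (k - 3)))"
    using assms by (intro sum.cong) (auto simp: card_M_of_card_ge_3)
  ultimately show ?thesis
    using assms M_of_card_1[OF assms, of n] card_M_of_card_2[OF assms(1), of q n]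
    by (simp add: of_nat_diff)
qed

theorem theorem1p2:
  fixes p q n :: nat
  assumes "p \<ge> 1" and "q \<ge> 1" and "n \<ge> 1" and "p < q"
  shows "(n \<le> q - 1 \<longrightarrow> card (M p q n) = 0) \<and>
    (q \<le> n \<and> n \<le> 2 * q - 1 \<longrightarrow> card (M p q n) = 1) \<and>
    (n \<ge> 2 * q \<longrightarrow>
      int (card (M p q n)) =
        1 + (int n - 2 * int p) +
        (\<Sum>k \<in> {k :: nat. 3 \<le> k \<and> real k \<le> (real n + 2) / (real q + 1)}.
          \<Sum>i = q * k..n + 2 - k.
            (int i - int p * int k) * int ((n - i - 1) choose (k - 3))))"
proof -
  have range_eq: "{k. 3 \<le> k \<and> real k \<le> (real n + 2) / (real q + 1)} =
    {k. 3 \<le> k \<and> k * (q + 1) \<le> n + 2}"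
  proof -
    have "real k \<le> (real n + 2) / (real q + 1) \<longleftrightarrow> real (k * (q + 1)) \<le> real (n + 2)" for k
      by (simp add: pos_le_divide_eq algebra_simps)
    then show ?thesis
      by (simp only: of_nat_le_iff)
  qed
  have range_empty: "{k. 3 \<le> k \<and> k * (q + 1) \<le> n + 2} = {}" if "n < 2 * q"
  proof -
    have "3 * (q + 1) \<le> k * (q + 1)" if "3 \<le> k" for k
      using that by (rule mult_le_mono1)
    with that show ?thesis
      by fastforce
  qed
  note count = card_M[OF assms(1,4), of n]
  have "card (M p q n) = 0" if "n \<le> q - 1"
  proof -
    have "n < q" "n < 2 * q"
      using that assms by linarith+
    then show ?thesis
      using count unfolding range_empty[OF \<open>n < 2 * q\<close>] by simp
  qed
  moreover have "card (M p q n) = 1" if "q \<le> n" "n \<le> 2 * q - 1"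
  proof -
    have "n < 2 * q"
      using that assms by linarith
    then show ?thesis
      using count that unfolding range_empty[OF \<open>n < 2 * q\<close>] by simp
  qed
  ultimately show ?thesis
    unfolding range_eq using count by simp
qed

end
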